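(* Let $k$ be a positive integer and let $n \in \mathbb{C}$. If the partition algebra $\mathbb{C}A_k(n)$ is semisimple, then there exists a basis $M_k$ of $\mathbb{C}A_k(n)$ (as a $\mathbb{C}$-vector space) that has the structure of a monoid under the product operation on $\mathbb{C}A_k(n)$, i.e., $M_k$ is closed under the product of $\mathbb{C}A_k(n)$ and is a monoid under this operation.
   Context: Partition algebra. For a positive integer $k$, let $A_k$ be the set of all set-partitions of $\{1,2,\ldots,k,1',2',\ldots,k'\}$. A set-partition $\pi\in A_k$ is represented by any graph on these $2k$ vertices (with $1,\ldots,k$ placed in a top row and $1',\ldots,k'$ in a bottom row) whose connected components are the blocks of $\pi$. For $\pi_1,\pi_2\in A_k$, place $\pi_1$ above $\pi_2$ and identify the bottom vertex $i'$ of $\pi_1$ with the top vertex $i$ of $\pi_2$ for each $i$. Let $\pi_1\circ\pi_2\in A_k$ be the set-partition of the remaining top vertices (of $\pi_1$) and bottom vertices (of $\pi_2$) recording which of them are in the same connected component of this concatenation, and let $\ell(\pi_1,\pi_2)$ be the number of connected components of the concatenation contained entirely in the middle row. For $n\in\mathbb{C}$, the partition algebra $\mathbb{C}A_k(n)$ is the $\mathbb{C}$-vector space with basis $A_k$ and with the bilinear product determined by $\pi_1\pi_2 = n^{\ell(\pi_1,\pi_2)}\,(\pi_1\circ\pi_2)$ (with $n^0=1$). It is a unital associative algebra with identity $\{\{1,1'\},\ldots,\{k,k'\}\}$. A finite-dimensional $\mathbb{C}$-algebra is semisimple if it is isomorphic to a direct sum of full matrix algebras over $\mathbb{C}$. 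*)

theory Defs
  imports "HOL-Algebra.QuotRing" "Jordan_Normal_Form.VS_Connect" "HOL-Library.Disjoint_Sets"
begin

section \<open>Set-partition diagrams and their concatenation\<close>

text \<open>\<open>Inl i\<close> is the top vertex \<open>i\<close>, and \<open>Inr i\<close> is the bottom vertex \<open>i'\<close>.\<close>

type_synonym diagram = "(nat + nat) set set"

definition diagrams :: "nat \<Rightarrow> diagram set" where
  "diagrams k = {p. partition_on ({1..k} <+> {1..k}) p}"

datatype vertex3 = Top nat | Mid nat | Bot nat

abbreviation upper :: "nat + nat \<Rightarrow> vertex3" where "upper \<equiv> case_sum Top Mid"
abbreviation lower :: "nat + nat \<Rightarrow> vertex3" where "lower \<equiv> case_sum Mid Bot"
abbreviation outer :: "nat + nat \<Rightarrow> vertex3" where "outer \<equiv> case_sum Top Bot"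

definition vertices3 :: "nat \<Rightarrow> vertex3 set" where
  "vertices3 k = Top ` {1..k} \<union> Mid ` {1..k} \<union> Bot ` {1..k}"

text \<open>Each diagram is represented by the graph in which every block is a clique (with loops), so
  the edge relation of the concatenation is symmetric and its connected components are the classes
  of the reflexive transitive closure.\<close>

definition concat_edges :: "diagram \<Rightarrow> diagram \<Rightarrow> vertex3 rel" where
  "concat_edges p q = (\<Union>B\<in>p. upper ` B \<times> upper ` B) \<union> (\<Union>B\<in>q. lower ` B \<times> lower ` B)"

definition components :: "nat \<Rightarrow> diagram \<Rightarrow> diagram \<Rightarrow> vertex3 set set" where
  "components k p q = vertices3 k // (concat_edges p q)\<^sup>*"

definition diagram_comp :: "nat \<Rightarrow> diagram \<Rightarrow> diagram \<Rightarrow> diagram" where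
  "diagram_comp k p q = {outer -` C | C. C \<in> components k p q} - {{}}"

definition middle_count :: "nat \<Rightarrow> diagram \<Rightarrow> diagram \<Rightarrow> nat" where
  "middle_count k p q = card {C \<in> components k p q. C \<subseteq> range Mid}"

definition diagram_id :: "nat \<Rightarrow> diagram" where
  "diagram_id k = {{Inl i, Inr i} | i. i \<in> {1..k}}"


section \<open>The partition algebra\<close>

text \<open>An element is given by its coefficients with respect to the diagram basis.\<close>

definition basis_vec :: "diagram \<Rightarrow> diagram \<Rightarrow> complex" where
  "basis_vec p = (\<lambda>q. if q = p then 1 else 0)"

definition partition_algebra :: "nat \<Rightarrow> complex \<Rightarrow> (complex, diagram \<Rightarrow> complex) module" where
  "partition_algebra k n = \<lparr>
     carrier = {f. \<forall>p. p \<notin> diagrams k \<longrightarrow> f p = 0},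
     mult = (\<lambda>f g r. \<Sum>(p, q) \<in> {(p, q) \<in> diagrams k \<times> diagrams k. diagram_comp k p q = r}.
               f p * g q * n ^ middle_count k p q),
     one = basis_vec (diagram_id k),
     zero = (\<lambda>p. 0),
     add = (\<lambda>f g p. f p + g p),
     smult = (\<lambda>c f p. c * f p)\<rparr>"


section \<open>Semisimplicity\<close>

definition direct_sum_algebra ::
    "'i set \<Rightarrow> ('i \<Rightarrow> ('a, 'b) module) \<Rightarrow> ('a, 'i \<Rightarrow> 'b) module" where
  "direct_sum_algebra I A = \<lparr>
     carrier = (\<Pi>\<^sub>E i\<in>I. carrier (A i)),
     mult = (\<lambda>x y. \<lambda>i\<in>I. x i \<otimes>\<^bsub>A i\<^esub> y i),
     one = (\<lambda>i\<in>I. \<one>\<^bsub>A i\<^esub>),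
     zero = (\<lambda>i\<in>I. \<zero>\<^bsub>A i\<^esub>),
     add = (\<lambda>x y. \<lambda>i\<in>I. x i \<oplus>\<^bsub>A i\<^esub> y i),
     smult = (\<lambda>c x. \<lambda>i\<in>I. c \<odot>\<^bsub>A i\<^esub> x i)\<rparr>"

definition algebra_iso :: "(complex, 'a) module \<Rightarrow> (complex, 'b) module \<Rightarrow> ('a \<Rightarrow> 'b) set" where
  "algebra_iso A B = ring_iso A B \<inter> LinearCombinations.module_hom class_ring A B"

text \<open>The \<open>i\<close>-th summand below is the algebra of square matrices of size \<open>d i\<close>.\<close>

definition semisimple_algebra :: "(complex, 'a) module \<Rightarrow> bool" where
  "semisimple_algebra A \<longleftrightarrow>
     (\<exists>(r :: nat) (d :: nat \<Rightarrow> nat). (\<forall>i<r. d i > 0) \<and>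
        algebra_iso A
          (direct_sum_algebra {..<r} (\<lambda>i. module_mat TYPE(complex) (d i) (d i))) \<noteq> {})"


section \<open>Basic facts\<close>

lemma finite_diagrams: "finite (diagrams k)"
proof (rule finite_subset)
  show "diagrams k \<subseteq> Pow (Pow ({1..k} <+> {1..k}))"
    by (auto simp: diagrams_def partition_on_def)
qed simp

lemma diagram_id_in_diagrams: "diagram_id k \<in> diagrams k"
proof -
  have "\<Union> (diagram_id k) = {1..k} <+> {1..k}"
    unfolding diagram_id_def by blast
  then show ?thesis
    by (auto simp: diagrams_def partition_on_def disjoint_def diagram_id_def)
qed

lemma concat_edges_subset:
  assumes "p \<in> diagrams k" "q \<in> diagrams k"
  shows "concat_edges p q \<subseteq> vertices3 k \<times> vertices3 k"
proof -
  have 1: "upper x \<in> vertices3 k \<and> lower x \<in> vertices3 k"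
    if "x \<in> {1..k} <+> {1..k}" for x
    using that by (auto simp: vertices3_def)
  have 2: "B \<subseteq> {1..k} <+> {1..k}" if "B \<in> p \<or> B \<in> q" for B
    using assms that by (auto simp: diagrams_def partition_on_def)
  show ?thesis
    unfolding concat_edges_def using 1 2 by fast
qed

lemma diagram_comp_in_diagrams:
  assumes "p \<in> diagrams k" "q \<in> diagrams k"
  shows "diagram_comp k p q \<in> diagrams k"
proof -
  let ?E = "concat_edges p q" and ?V = "vertices3 k"
  have sym: "sym (?E\<^sup>*)"
    by (rule sym_rtrancl) (auto simp: sym_def concat_edges_def)
  have closed: "y \<in> ?V" if "(x, y) \<in> ?E\<^sup>*" "x \<in> ?V" for x y
    using that concat_edges_subset[OF assms] by (induction rule: rtrancl_induct) auto
  have sub: "C \<subseteq> ?V" if "C \<in> components k p q" for C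
    using that closed by (auto simp: components_def quotient_def)
  have cover: "\<exists>C\<in>components k p q. x \<in> C" if "x \<in> ?V" for x
    using that by (auto simp: components_def quotient_def)
  have disj: "C = D" if "C \<in> components k p q" "D \<in> components k p q" "x \<in> C" "x \<in> D" for C D x
  proof -
    obtain a b where ab: "C = ?E\<^sup>* `` {a}" "D = ?E\<^sup>* `` {b}"
      using \<open>C \<in> _\<close> \<open>D \<in> _\<close> by (auto simp: components_def quotient_def)
    have "(a, x) \<in> ?E\<^sup>*" "(b, x) \<in> ?E\<^sup>*" using ab that by auto
    then have "(a, b) \<in> ?E\<^sup>*" "(b, a) \<in> ?E\<^sup>*"
      using sym by (meson rtrancl_trans symD)+
    then show ?thesis unfolding ab by (auto intro: rtrancl_trans)
  qed
  have outer_in: "outer x \<in> ?V \<longleftrightarrow> x \<in> {1..k} <+> {1..k}" for x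
    by (cases x) (auto simp: vertices3_def)
  show ?thesis
    unfolding diagrams_def mem_Collect_eq
  proof (rule partition_onI)
    show "\<Union> (diagram_comp k p q) = {1..k} <+> {1..k}"
    proof (intro equalityI subsetI)
      fix x assume "x \<in> \<Union> (diagram_comp k p q)"
      then obtain C where "C \<in> components k p q" "outer x \<in> C"
        by (auto simp: diagram_comp_def)
      then show "x \<in> {1..k} <+> {1..k}" using sub outer_in by blast
    next
      fix x assume "x \<in> {1..k} <+> {1..k}"
      then obtain C where "C \<in> components k p q" "outer x \<in> C" using cover outer_in by blast
      then have "outer -` C \<in> diagram_comp k p q" "x \<in> outer -` C"
        by (auto simp: diagram_comp_def)
      then show "x \<in> \<Union> (diagram_comp k p q)" by blast
    qed
  next
    fix B B' assume "B \<in> diagram_comp k p q" "B' \<in> diagram_comp k p q" "B \<noteq> B'"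
    then show "disjnt B B'"
      using disj by (fastforce simp: diagram_comp_def disjnt_def)
  next
    show "{} \<notin> diagram_comp k p q" by (simp add: diagram_comp_def)
  qed
qed

lemma mult_basis_vec:
  assumes "p \<in> diagrams k" "q \<in> diagrams k"
  shows "basis_vec p \<otimes>\<^bsub>partition_algebra k n\<^esub> basis_vec q =
    (n ^ middle_count k p q) \<odot>\<^bsub>partition_algebra k n\<^esub> basis_vec (diagram_comp k p q)"
proof
  fix r
  let ?S = "{(p', q') \<in> diagrams k \<times> diagrams k. diagram_comp k p' q' = r}"
  have fin: "finite ?S"
    by (rule finite_subset[of _ "diagrams k \<times> diagrams k"]) (auto simp: finite_diagrams)
  have "(basis_vec p \<otimes>\<^bsub>partition_algebra k n\<^esub> basis_vec q) r =
      (\<Sum>z\<in>?S. if z = (p, q) then n ^ middle_count k p q else 0)"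
    by (auto simp: partition_algebra_def basis_vec_def intro!: sum.cong)
  also have "\<dots> = (if diagram_comp k p q = r then n ^ middle_count k p q else 0)"
    using assms fin by (simp add: sum.delta)
  finally show "(basis_vec p \<otimes>\<^bsub>partition_algebra k n\<^esub> basis_vec q) r =
      ((n ^ middle_count k p q) \<odot>\<^bsub>partition_algebra k n\<^esub> basis_vec (diagram_comp k p q)) r"
    by (auto simp: partition_algebra_def basis_vec_def)
qed

lemma mult_closed: "f \<otimes>\<^bsub>partition_algebra k n\<^esub> g \<in> carrier (partition_algebra k n)"
  by (auto simp: partition_algebra_def diagram_comp_in_diagrams intro!: sum.neutral)

lemma vectorspace_partition_algebra: "vectorspace class_ring (partition_algebra k n)"
proof -
  let ?A = "partition_algebra k n"
  have grp: "abelian_group ?A"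
  proof (rule abelian_groupI)
    fix x assume "x \<in> carrier ?A"
    then show "\<exists>y\<in>carrier ?A. y \<oplus>\<^bsub>?A\<^esub> x = \<zero>\<^bsub>?A\<^esub>"
      by (intro bexI[of _ "\<lambda>p. - x p"]) (auto simp: partition_algebra_def)
  qed (auto simp: partition_algebra_def fun_eq_iff)
  have "module (class_ring :: complex ring) ?A"
    by (rule moduleI[OF class_cring.is_cring grp])
      (auto simp: partition_algebra_def fun_eq_iff algebra_simps)
  moreover have "field (class_ring :: complex ring)"
    by (rule class_field.field_axioms)
  ultimately show ?thesis
    by (simp add: vectorspace_def)
qed

end

theory Submission
  imports Defs "HOL-Combinatorics.Permutations"
begin

text \<open>The permutation diagrams span the quotient \<open>\<complex>S\<^sub>k\<close> of \<open>\<complex>A\<^sub>k(n)\<close> by the ideal of all other diagrams, so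
  for \<open>k \<ge> 2\<close> the trivial and the sign character are two distinct characters of \<open>\<complex>A\<^sub>k(n)\<close>; in a sum of
  matrix algebras each character is the projection to a block of size one. For \<open>k = 1\<close> the algebra
  has dimension two, which forces two blocks of size one as well. Given two such blocks \<open>a\<close> and \<open>b\<close>,
  with \<open>\<epsilon>\<^sub>a\<close> the unit of the block \<open>a\<close>, the matrix units of the blocks other than \<open>a\<close> and \<open>b\<close> form
  with \<open>0\<close> a semigroup; translating it by \<open>\<epsilon>\<^sub>a\<close> turns \<open>0\<close> into a basis vector, and adjoining the
  identity accounts for the block \<open>b\<close>.\<close>


section \<open>Permutation diagrams and their characters\<close>

definition perm_diagram :: "nat \<Rightarrow> (nat \<Rightarrow> nat) \<Rightarrow> diagram" where
  "perm_diagram k s = {{Inl i, Inr (s i)} | i. i \<in> {1..k}}"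

lemma perm_diagram_id: "perm_diagram k id = diagram_id k"
  by (simp add: perm_diagram_def diagram_id_def)

lemma vimage_perm_diagram:
  assumes "s permutes {1..k}"
  shows "vimage (map_sum s id) ` perm_diagram k t = perm_diagram k (t \<circ> s)"
proof -
  have bij: "bij s" using assms by (rule permutes_bij)
  have *: "map_sum s id -` {Inl (s i), Inr j} = {Inl i, Inr j}" for i j
  proof -
    have "x \<in> map_sum s id -` {Inl (s i), Inr j} \<longleftrightarrow> x \<in> {Inl i, Inr j}" for x
      using bij by (cases x) (auto dest: bij_is_inj injD)
    then show ?thesis by blast
  qed
  have image: "perm_diagram k u = (\<lambda>i. {Inl i, Inr (u i)}) ` {1..k}" for u
    unfolding perm_diagram_def by (rule Setcompr_eq_image)
  have "perm_diagram k t = (\<lambda>i. {Inl i, Inr (t i)}) ` s ` {1..k}"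
    unfolding image permutes_image[OF assms] ..
  then show ?thesis by (simp only: image image_image * comp_apply)
qed

lemma perm_diagram_in_diagrams:
  assumes "s permutes {1..k}"
  shows "perm_diagram k s \<in> diagrams k"
proof -
  have inj: "inj s" using assms by (rule permutes_inj)
  have "\<Union> (perm_diagram k s) = Inl ` {1..k} \<union> Inr ` s ` {1..k}"
    unfolding perm_diagram_def by blast
  then have "\<Union> (perm_diagram k s) = {1..k} <+> {1..k}"
    by (simp only: permutes_image[OF assms] Plus_def)
  then show ?thesis
    using inj by (auto simp: diagrams_def partition_on_def disjoint_def perm_diagram_def dest: injD)
qed

lemma perm_diagram_inj:
  assumes "s permutes {1..k}" "t permutes {1..k}" "perm_diagram k s = perm_diagram k t"
  shows "s = t"
proof
  fix i
  show "s i = t i"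
  proof (cases "i \<in> {1..k}")
    case True
    then have "{Inl i, Inr (s i)} \<in> perm_diagram k t"
      using assms(3) by (auto simp: perm_diagram_def)
    then obtain j where "{Inl i, Inr (s i)} = {Inl j, Inr (t j)}"
      by (auto simp: perm_diagram_def)
    then show ?thesis by (auto simp: doubleton_eq_iff)
  next
    case False
    then show ?thesis using assms(1,2) by (metis permutes_not_in)
  qed
qed

section \<open>Components of a concatenation with a permutation diagram on top\<close>

lemma quotient_rtrancl_eqI:
  assumes "\<Union>P = V"
    and "\<And>C x y. C \<in> P \<Longrightarrow> x \<in> C \<Longrightarrow> (x, y) \<in> E \<Longrightarrow> y \<in> C"
    and "\<And>C x y. C \<in> P \<Longrightarrow> x \<in> C \<Longrightarrow> y \<in> C \<Longrightarrow> (x, y) \<in> E\<^sup>*"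
    and "{} \<notin> P"
  shows "V // E\<^sup>* = P"
\<comment> \<open>Members of \<open>P\<close> are closed under \<open>E\<close> and connected
  inside, so each is the reachability class of any of its points. This identifies the quotient
  directly, without symmetry of \<open>E\<close> or disjointness of \<open>P\<close>.\<close>
proof -
  have cl: "E\<^sup>* `` {x} = C" if "C \<in> P" "x \<in> C" for C x
  proof -
    have "y \<in> C" if "(x, y) \<in> E\<^sup>*" for y
      using that by (induction rule: rtrancl_induct) (use \<open>C \<in> P\<close> \<open>x \<in> C\<close> assms(2) in auto)
    then show ?thesis using assms(3) that by auto
  qed
  show ?thesis
  proof (intro equalityI subsetI)
    fix D assume "D \<in> V // E\<^sup>*"
    then obtain x where "x \<in> V" "D = E\<^sup>* `` {x}" by (rule quotientE)
    then show "D \<in> P" using cl assms(1) by blast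
  next
    fix C assume "C \<in> P"
    moreover obtain x where "x \<in> C" using \<open>C \<in> P\<close> assms(4) by (metis ex_in_conv)
    ultimately show "C \<in> V // E\<^sup>*" using cl assms(1) by (metis UnionI quotientI)
  qed
qed

text \<open>The map \<open>g\<close> contracts the edges from \<open>Top i\<close> to \<open>Mid (s i)\<close>, so that the components of the
  concatenation are the preimages of the blocks of \<open>q\<close>.\<close>

lemma components_perm_diagram:
  assumes "s permutes {1..k}" "q \<in> diagrams k"
  defines "g \<equiv> case_vertex3 (Inl \<circ> s) Inl Inr"
  shows "components k (perm_diagram k s) q = vimage g ` q"
  unfolding components_def
proof (rule quotient_rtrancl_eqI)
  let ?E = "concat_edges (perm_diagram k s) q"
  have part: "partition_on ({1..k} <+> {1..k}) q" using assms(2) by (simp add: diagrams_def)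
  have sk: "s i \<in> {1..k} \<longleftrightarrow> i \<in> {1..k}" for i using permutes_in_image[OF assms(1)] .
  have inV: "v \<in> vertices3 k \<longleftrightarrow> g v \<in> {1..k} <+> {1..k}" for v
    using sk by (cases v) (auto simp: vertices3_def g_def simp del: atLeastAtMost_iff One_nat_def)
  have Un: "\<Union>q = {1..k} <+> {1..k}" using part by (simp add: partition_on_def)
  have sym: "sym (?E\<^sup>*)" by (rule sym_rtrancl) (auto simp: sym_def concat_edges_def)
  show "\<Union> (vimage g ` q) = vertices3 k"
  proof -
    have "g -` \<Union>q = vertices3 k"
      by (simp only: Un set_eq_iff vimage_eq inV) simp
    then show ?thesis by (simp only: vimage_Union)
  qed
  \<comment> \<open>\<open>lower\<close> is a section of \<open>g\<close>: every fibre of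
    \<open>g\<close> has a representative among the vertices of \<open>q\<close>, to which
    \<open>contract\<close> below connects all its points.\<close>
  have glow: "g (lower z) = z" for z by (cases z) (auto simp: g_def)
  show "y \<in> C" if C: "C \<in> vimage g ` q" and "x \<in> C" "(x, y) \<in> ?E" for C x y
  proof -
    obtain B where B: "B \<in> q" "C = g -` B" using C by blast
    from \<open>(x, y) \<in> ?E\<close> consider i where "x \<in> {Top i, Mid (s i)}" "y \<in> {Top i, Mid (s i)}"
      | B' where "B' \<in> q" "x \<in> lower ` B'" "y \<in> lower ` B'"
      unfolding concat_edges_def perm_diagram_def by fastforce
    then show ?thesis
    proof cases
      case 1
      then have "g x = g y" by (auto simp: g_def)
      then show ?thesis using B \<open>x \<in> C\<close> by simp
    next
      case 2
      then have "g x \<in> B'" "g y \<in> B'" using glow by auto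
      moreover have "g x \<in> B" using \<open>x \<in> C\<close> B by simp
      ultimately have "B' = B" using part 2(1) B(1)
        by (metis disjnt_iff partition_onD2 disjointD Int_iff empty_iff)
      then show ?thesis using \<open>g y \<in> B'\<close> B by simp
    qed
  qed
  have contract: "(x, lower (g x)) \<in> ?E\<^sup>*" if "x \<in> vertices3 k" for x
  proof (cases x)
    case (Top i)
    then have "i \<in> {1..k}" using that by (auto simp: vertices3_def)
    then have "{Inl i, Inr (s i)} \<in> perm_diagram k s" by (auto simp: perm_diagram_def)
    moreover have "(Top i, Mid (s i)) \<in> upper ` {Inl i, Inr (s i)} \<times> upper ` {Inl i, Inr (s i)}"
      by simp
    ultimately have "(Top i, Mid (s i)) \<in> ?E" unfolding concat_edges_def by blast
    then show ?thesis using Top by (auto simp: g_def)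
  qed (auto simp: g_def)
  show "(x, y) \<in> ?E\<^sup>*" if C: "C \<in> vimage g ` q" "x \<in> C" "y \<in> C" for C x y
  proof -
    obtain B where B: "B \<in> q" "g x \<in> B" "g y \<in> B" using C by blast
    then have "(lower (g x), lower (g y)) \<in> ?E" unfolding concat_edges_def by blast
    moreover have "x \<in> vertices3 k" "y \<in> vertices3 k" using B Un inV by blast+
    ultimately show ?thesis
      using contract sym by (meson r_into_rtrancl rtrancl_trans symD)
  qed
  have "g -` B \<noteq> {}" if B: "B \<in> q" for B
  proof -
    obtain z where "z \<in> B" using part B by (metis ex_in_conv partition_onD3)
    then show ?thesis using glow[of z] by auto
  qed
  then show "{} \<notin> vimage g ` q" by auto
qed

text \<open>On outer vertices the contraction is \<open>map_sum s id\<close>, a bijection. So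
  restricting a component to the outer rows pulls a block of \<open>q\<close> back along this
  bijection. The result is never empty, hence no component lies in the middle row.\<close>

lemma perm_diagram_comp:
  assumes s: "s permutes {1..k}" and q: "q \<in> diagrams k"
  shows "diagram_comp k (perm_diagram k s) q = vimage (map_sum s id) ` q"
    and "middle_count k (perm_diagram k s) q = 0"
proof -
  let ?g = "case_vertex3 (Inl \<circ> s) Inl Inr"
  have ne: "\<exists>x. map_sum s id x \<in> B" if B: "B \<in> q" for B
  proof -
    have "{} \<notin> q" using q by (auto simp: diagrams_def partition_on_def)
    then obtain z where z: "z \<in> B" using B by (metis ex_in_conv)
    have "map_sum s id (map_sum (inv_into UNIV s) id z) = z"
      using permutes_inverses(1)[OF s] by (cases z) auto
    then show ?thesis using z by metis
  qed
  have og: "outer -` ?g -` B = map_sum s id -` B" for B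
  proof -
    have "?g (outer x) = map_sum s id x" for x by (cases x) auto
    then show ?thesis by auto
  qed
  show "diagram_comp k (perm_diagram k s) q = vimage (map_sum s id) ` q"
    unfolding diagram_comp_def components_perm_diagram[OF s q] using ne
    by (auto simp: og image_iff; metis og)
  have "\<not> ?g -` B \<subseteq> range Mid" if B: "B \<in> q" for B
  proof -
    obtain x where "map_sum s id x \<in> B" using ne[OF B] by blast
    then have "outer x \<in> ?g -` B" using og by blast
    moreover have "outer x \<notin> range Mid" by (cases x) auto
    ultimately show ?thesis by blast
  qed
  then have "{C \<in> components k (perm_diagram k s) q. C \<subseteq> range Mid} = {}"
    unfolding components_perm_diagram[OF s q] by auto
  then show "middle_count k (perm_diagram k s) q = 0" by (simp only: middle_count_def card.empty)
qed

lemma perm_diagram_comp_perm: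
  assumes "s permutes {1..k}" "t permutes {1..k}"
  shows "diagram_comp k (perm_diagram k s) (perm_diagram k t) = perm_diagram k (t \<circ> s)"
  using assms by (simp add: perm_diagram_comp perm_diagram_in_diagrams vimage_perm_diagram)

section \<open>Factors of a permutation diagram\<close>

lemma diagram_comp_same_block:
  assumes "p \<in> diagrams k" "q \<in> diagrams k" "i \<in> {1..k}"
    and B: "B \<in> diagram_comp k p q" "Inl i \<in> B"
  shows "x \<in> B \<longleftrightarrow> (Top i, outer x) \<in> (concat_edges p q)\<^sup>*"
proof -
  let ?E = "concat_edges p q"
  have sym: "sym (?E\<^sup>*)" by (rule sym_rtrancl) (auto simp: sym_def concat_edges_def)
  obtain v where v: "B = outer -` (?E\<^sup>* `` {v})"
    using B by (auto simp: diagram_comp_def components_def quotient_def)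
  have "(v, Top i) \<in> ?E\<^sup>*" "(Top i, v) \<in> ?E\<^sup>*" using B(2) v sym by (auto dest: symD)
  then show ?thesis unfolding v by (auto intro: rtrancl_trans)
qed

text \<open>Concatenation never separates what \<open>p\<close> joins, so a block of
  \<open>p\<close> has at most one top vertex. A block with a top vertex must also reach the bottom
  row of \<open>p\<close>, since otherwise that vertex could not be connected to \<open>r i\<close>
  below. Choosing a bottom vertex for each top vertex gives an injection of \<open>{1..k}\<close>
  into itself; its surjectivity leaves no room for further bottom vertices in a block or for blocks
  without top vertices.\<close>

lemma diagram_comp_perm_left:
  assumes p: "p \<in> diagrams k" and q: "q \<in> diagrams k" and r: "r permutes {1..k}"
    and eq: "diagram_comp k p q = perm_diagram k r"
  shows "\<exists>s. s permutes {1..k} \<and> p = perm_diagram k s"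
proof -
  let ?E = "concat_edges p q"
  have part: "partition_on ({1..k} <+> {1..k}) p" using p by (simp add: diagrams_def)
  have Un: "\<Union>p = {1..k} <+> {1..k}" using part by (simp add: partition_on_def)
  have dis: "B = B'" if "B \<in> p" "B' \<in> p" "x \<in> B" "x \<in> B'" for B B' x
    using part that by (metis partition_onD2 disjointD Int_iff empty_iff)
  have blk: "x \<in> {Inl i, Inr (r i)} \<longleftrightarrow> (Top i, outer x) \<in> ?E\<^sup>*" if "i \<in> {1..k}" for i x
    by (rule diagram_comp_same_block[OF p q that])
      (use that in \<open>auto simp: eq perm_diagram_def\<close>)
  have top: "i = i'" if "B \<in> p" "Inl i \<in> B" "Inl i' \<in> B" for B i i'
  proof -
    have "(upper (Inl i), upper (Inl i')) \<in> ?E" unfolding concat_edges_def using that by blast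
    moreover have "i \<in> {1..k}" using Un that by blast
    ultimately show ?thesis using blk[of i "Inl i'"] by auto
  qed
  have bot: "\<exists>j. Inr j \<in> B" if B: "B \<in> p" "Inl i \<in> B" for B i
  proof (rule ccontr)
    assume *: "\<not> ?thesis"
    then have Bl: "B \<subseteq> range Inl" by (metis obj_sumE rangeI subsetI)
    have i: "i \<in> {1..k}" using Un B by blast
    \<comment> \<open>Without bottom vertices, \<open>B\<close> appears as a set of
      \<open>Top\<close> vertices only. Edges from \<open>q\<close> do not touch these, so paths
      from \<open>Top i\<close> never leave \<open>B\<close>.\<close>
    have "v \<in> upper ` B" if "(Top i, v) \<in> ?E\<^sup>*" for v
      using that
    proof (induction rule: rtrancl_induct)
      case base
      then show ?case using B(2) by force
    next
      case (step u v)
      then obtain j where j: "u = Top j" "Inl j \<in> B" using Bl by force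
      have "\<not> (Top j \<in> lower ` B')" for B' :: "(nat + nat) set" by (auto split: sum.splits)
      then obtain B' where B': "B' \<in> p" "Top j \<in> upper ` B'" "v \<in> upper ` B'"
        using step(2) unfolding concat_edges_def j(1) by blast
      then have "Inl j \<in> B'" by (auto split: sum.splits)
      then have "B' = B" using dis B'(1) B(1) j(2) by blast
      then show ?case using B' by simp
    qed
    moreover have "(Top i, outer (Inr (r i))) \<in> ?E\<^sup>*" using blk[OF i] by blast
    ultimately have "Bot (r i) \<in> upper ` B" by auto
    then show False by (auto split: sum.splits)
  qed
  have ex: "\<exists>j. \<exists>B\<in>p. Inl i \<in> B \<and> Inr j \<in> B" if "i \<in> {1..k}" for i
    using bot Un that by (metis InlI UnionE)
  \<comment> \<open>Outside \<open>{1..k}\<close> the map is the identity, as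
    \<open>permutes\<close> demands.\<close>
  define s where "s i = (if i \<in> {1..k} then SOME j. \<exists>B\<in>p. Inl i \<in> B \<and> Inr j \<in> B else i)" for i
  have s: "\<exists>B\<in>p. Inl i \<in> B \<and> Inr (s i) \<in> B" if "i \<in> {1..k}" for i
    unfolding s_def using someI_ex[OF ex[OF that]] that by simp
  have inj: "inj_on s {1..k}"
  proof (rule inj_onI)
    fix i i' assume "i \<in> {1..k}" "i' \<in> {1..k}" "s i = s i'"
    then show "i = i'" using s[of i] s[of i'] dis top by metis
  qed
  have "s ` {1..k} \<subseteq> {1..k}"
  proof
    fix j assume "j \<in> s ` {1..k}"
    then show "j \<in> {1..k}" using s Un by blast
  qed
  then have img: "s ` {1..k} = {1..k}" using inj by (simp add: endo_inj_surj)
  then have perm: "s permutes {1..k}"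
    using inj by (intro bij_imp_permutes) (auto simp: bij_betw_def s_def)
  have block: "B = {Inl i, Inr (s i)}" if B: "B \<in> p" "Inl i \<in> B" for B i
  proof -
    have i: "i \<in> {1..k}" using Un B by blast
    have si: "Inr (s i) \<in> B" using s[OF i] dis B by metis
    have "x \<in> {Inl i, Inr (s i)}" if x: "x \<in> B" for x
    proof (cases x)
      case (Inl i')
      then show ?thesis using top B x by auto
    next
      case (Inr j)
      then have "j \<in> {1..k}" using Un B x by blast
      \<comment> \<open>Every bottom vertex is already the chosen partner of some top vertex
        \<open>i'\<close>. Lying in \<open>B\<close>, it pulls \<open>i'\<close> into
        \<open>B\<close>, and then \<open>i' = i\<close> by \<open>top\<close>.\<close>
      then obtain i' where i': "i' \<in> {1..k}" "j = s i'" using img by blast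
      then have "Inl i' \<in> B" using s[OF i'(1)] dis B x Inr by metis
      then show ?thesis using top B i' Inr by auto
    qed
    then show ?thesis using B si by blast
  qed
  have "p = perm_diagram k s"
  proof (intro equalityI subsetI)
    fix B assume B: "B \<in> p"
    then obtain x where x: "x \<in> B" using part by (metis ex_in_conv partition_onD3)
    have "\<exists>i. Inl i \<in> B"
    proof (cases x)
      case (Inr j)
      then have "j \<in> {1..k}" using Un B x by blast
      then obtain i where "i \<in> {1..k}" "j = s i" using img by blast
      then show ?thesis using s[of i] dis B x Inr by metis
    qed (use x in auto)
    then obtain i where "Inl i \<in> B" ..
    then have "B = {Inl i, Inr (s i)}" "i \<in> {1..k}" using block B Un by blast+
    then show "B \<in> perm_diagram k s" by (auto simp: perm_diagram_def)
  next
    fix B assume "B \<in> perm_diagram k s"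
    then obtain i where i: "i \<in> {1..k}" "B = {Inl i, Inr (s i)}" by (auto simp: perm_diagram_def)
    then obtain B' where "B' \<in> p" "Inl i \<in> B'" using s by blast
    then show "B \<in> p" using block i by metis
  qed
  then show ?thesis using perm by blast
qed

text \<open>Composing with \<open>perm_diagram k s\<close> on top only relabels top vertices;
  relabelling back by the inverse of \<open>s\<close> recovers \<open>q\<close>, now as the diagram
  of \<open>r\<close> composed with this inverse.\<close>

lemma diagram_comp_perm_right:
  assumes s: "s permutes {1..k}" and q: "q \<in> diagrams k" and r: "r permutes {1..k}"
    and eq: "diagram_comp k (perm_diagram k s) q = perm_diagram k r"
  shows "\<exists>t. t permutes {1..k} \<and> q = perm_diagram k t"
proof -
  have "map_sum (inv_into UNIV s) id -` map_sum s id -` B = B" for B :: "(nat + nat) set"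
  proof -
    have "map_sum s id (map_sum (inv_into UNIV s) id z) = z" for z :: "nat + nat"
      using permutes_inverses(1)[OF s] by (cases z) auto
    then show ?thesis by auto
  qed
  then have "q = vimage (map_sum (inv_into UNIV s) id) ` vimage (map_sum s id) ` q"
    by (simp add: image_image)
  also have "vimage (map_sum s id) ` q = perm_diagram k r"
    using eq perm_diagram_comp(1)[OF s q] by simp
  also have "vimage (map_sum (inv_into UNIV s) id) ` \<dots> = perm_diagram k (r \<circ> inv_into UNIV s)"
    by (rule vimage_perm_diagram) (rule permutes_inv[OF s])
  finally show ?thesis using permutes_compose[OF permutes_inv[OF s] r] by blast
qed

text \<open>This is the ideal property of the remaining diagrams: a product involving one of them
  never contributes to the coefficient of a permutation diagram. The order in
  \<open>t \<circ> s\<close> comes from stacking \<open>s\<close> above \<open>t\<close>.\<close>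

lemma diagram_comp_eq_perm:
  assumes "r permutes {1..k}"
  shows "{(p, q) \<in> diagrams k \<times> diagrams k. diagram_comp k p q = perm_diagram k r} =
    (\<lambda>(s, t). (perm_diagram k s, perm_diagram k t)) `
      {(s, t). s permutes {1..k} \<and> t permutes {1..k} \<and> t \<circ> s = r}"
    (is "?L = ?R")
proof (intro equalityI subsetI)
  fix z assume "z \<in> ?L"
  then obtain p q where z: "z = (p, q)" "p \<in> diagrams k" "q \<in> diagrams k"
    "diagram_comp k p q = perm_diagram k r" by blast
  then obtain s where s: "s permutes {1..k}" "p = perm_diagram k s"
    using diagram_comp_perm_left assms by blast
  then obtain t where t: "t permutes {1..k}" "q = perm_diagram k t"
    using diagram_comp_perm_right z assms by blast
  have "t \<circ> s = r"
    using z(4) s t assms permutes_compose perm_diagram_comp_perm perm_diagram_inj by metis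
  then show "z \<in> ?R" using z(1) s t by auto
next
  fix z assume "z \<in> ?R"
  then show "z \<in> ?L" by (auto simp: perm_diagram_comp_perm perm_diagram_in_diagrams)
qed

section \<open>Characters of the symmetric group inflated to the partition algebra\<close>

definition perm_character :: "nat \<Rightarrow> ((nat \<Rightarrow> nat) \<Rightarrow> complex) \<Rightarrow> (diagram \<Rightarrow> complex) \<Rightarrow> complex" where
  "perm_character k e f = (\<Sum>s | s permutes {1..k}. f (perm_diagram k s) * e s)"

text \<open>At a permutation diagram \<open>r\<close> the product is a convolution over the
  factorizations \<open>t \<circ> s = r\<close>, in which no power of \<open>n\<close> survives
  because \<open>middle_count\<close> vanishes. Summing over all \<open>r\<close> runs over all
  pairs, and multiplicativity of \<open>e\<close> splits the double sum.\<close>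

lemma perm_character_mult:
  assumes e: "\<And>s t. s permutes {1..k} \<Longrightarrow> t permutes {1..k} \<Longrightarrow> e (t \<circ> s) = e s * e t"
  shows "perm_character k e (f \<otimes>\<^bsub>partition_algebra k n\<^esub> g) =
    perm_character k e f * perm_character k e g"
proof -
  let ?P = "{s. s permutes {1..k}}" and ?d = "perm_diagram k"
  have fin: "finite ?P" by (simp add: finite_permutations)
  have prod: "(f \<otimes>\<^bsub>partition_algebra k n\<^esub> g) (?d r) =
      (\<Sum>(s, t) \<in> {z \<in> ?P \<times> ?P. snd z \<circ> fst z = r}. f (?d s) * g (?d t))" if "r \<in> ?P" for r
  proof -
    let ?S = "{(s, t). s permutes {1..k} \<and> t permutes {1..k} \<and> t \<circ> s = r}"
    have S: "?S = {z \<in> ?P \<times> ?P. snd z \<circ> fst z = r}"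
      by (auto simp del: One_nat_def)
    have inj: "inj_on (\<lambda>(s, t). (?d s, ?d t)) ?S"
      using perm_diagram_inj by (intro inj_onI) (clarsimp; blast)
    have "(f \<otimes>\<^bsub>partition_algebra k n\<^esub> g) (?d r) =
      (\<Sum>(p, q) \<in> (\<lambda>(s, t). (?d s, ?d t)) ` ?S. f p * g q * n ^ middle_count k p q)"
      using that diagram_comp_eq_perm[of r k] by (simp add: partition_algebra_def)
    also have "\<dots> = (\<Sum>(s, t) \<in> ?S. f (?d s) * g (?d t))"
      unfolding sum.reindex[OF inj]
      by (rule sum.cong) (auto simp: perm_diagram_comp perm_diagram_in_diagrams)
    finally show ?thesis unfolding S .
  qed
  have "perm_character k e (f \<otimes>\<^bsub>partition_algebra k n\<^esub> g) =
      (\<Sum>r\<in>?P. \<Sum>z \<in> {z \<in> ?P \<times> ?P. snd z \<circ> fst z = r}. f (?d (fst z)) * g (?d (snd z)) * e (snd z \<circ> fst z))"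
    unfolding perm_character_def
    by (intro sum.cong refl) (simp add: prod sum_distrib_right case_prod_beta)
  also have "\<dots> = (\<Sum>z \<in> ?P \<times> ?P. f (?d (fst z)) * g (?d (snd z)) * e (snd z \<circ> fst z))"
    \<comment> \<open>The pairs \<open>(s, t)\<close> are grouped by their composite, which stays in
      the finite set of permutations.\<close>
    by (rule sum.group) (use fin in \<open>auto intro: permutes_compose simp del: One_nat_def\<close>)
  also have "\<dots> = (\<Sum>z \<in> ?P \<times> ?P. (f (?d (fst z)) * e (fst z)) * (g (?d (snd z)) * e (snd z)))"
    by (rule sum.cong) (auto simp: e)
  also have "\<dots> = perm_character k e f * perm_character k e g"
    unfolding perm_character_def sum_product sum.cartesian_product by (simp add: case_prod_beta)
  finally show ?thesis .
qed

lemma perm_character_basis_vec: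
  assumes "s permutes {1..k}"
  shows "perm_character k e (basis_vec (perm_diagram k s)) = e s"
proof -
  have "perm_character k e (basis_vec (perm_diagram k s)) =
      (\<Sum>t | t permutes {1..k}. if t = s then e s else 0)"
    unfolding perm_character_def
    by (rule sum.cong[OF refl]) (use perm_diagram_inj[OF _ assms] in \<open>force simp: basis_vec_def\<close>)
  then show ?thesis using assms by (simp add: finite_permutations)
qed


section \<open>Sums of matrix algebras\<close>

definition block_indices :: "nat \<Rightarrow> (nat \<Rightarrow> nat) \<Rightarrow> (nat \<times> nat \<times> nat) set" where
  "block_indices r d = {(s, i, j). s < r \<and> i < d s \<and> j < d s}"

lemma finite_block_indices: "finite (block_indices r d)"
proof -
  have "block_indices r d = (SIGMA s:{..<r}. {..<d s} \<times> {..<d s})"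
    by (auto simp: block_indices_def)
  then show ?thesis by simp
qed

text \<open>\<open>c x (s, i, j)\<close> is the entry \<open>(i, j)\<close> of the \<open>s\<close>-th matrix of \<open>x\<close>; it is meaningful only for
  indices in \<open>block_indices r d\<close>.\<close>

locale matrix_blocks = vectorspace "class_ring :: complex ring" A for A :: "(complex, 'a) module" +
  fixes r :: nat and d :: "nat \<Rightarrow> nat" and c :: "'a \<Rightarrow> nat \<times> nat \<times> nat \<Rightarrow> complex"
  assumes d_pos: "s < r \<Longrightarrow> d s > 0"
    and mult_closed: "x \<in> carrier A \<Longrightarrow> y \<in> carrier A \<Longrightarrow> x \<otimes>\<^bsub>A\<^esub> y \<in> carrier A"
    and unit_closed: "\<one>\<^bsub>A\<^esub> \<in> carrier A"
    and coord_add: "x \<in> carrier A \<Longrightarrow> y \<in> carrier A \<Longrightarrow> t \<in> block_indices r d \<Longrightarrow>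
      c (x \<oplus>\<^bsub>A\<^esub> y) t = c x t + c y t"
    and coord_smult: "x \<in> carrier A \<Longrightarrow> t \<in> block_indices r d \<Longrightarrow> c (z \<odot>\<^bsub>A\<^esub> x) t = z * c x t"
    and coord_mult: "x \<in> carrier A \<Longrightarrow> y \<in> carrier A \<Longrightarrow> (s, i, j) \<in> block_indices r d \<Longrightarrow>
      c (x \<otimes>\<^bsub>A\<^esub> y) (s, i, j) = (\<Sum>l<d s. c x (s, i, l) * c y (s, l, j))"
    and coord_unit: "(s, i, j) \<in> block_indices r d \<Longrightarrow> c \<one>\<^bsub>A\<^esub> (s, i, j) = of_bool (i = j)"
    and coord_eqI: "x \<in> carrier A \<Longrightarrow> y \<in> carrier A \<Longrightarrow>
      (\<And>t. t \<in> block_indices r d \<Longrightarrow> c x t = c y t) \<Longrightarrow> x = y"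
    and coord_surj: "\<exists>x\<in>carrier A. \<forall>t\<in>block_indices r d. c x t = f t"
begin

section \<open>Algebra structure read off from matrix coordinates\<close>

abbreviation J where "J \<equiv> block_indices r d"

text \<open>The inverse of the coordinate map. Values of \<open>f\<close> and of \<open>c\<close>
  outside \<open>J\<close> are ignored; existence is \<open>coord_surj\<close> and uniqueness is
  \<open>coord_eqI\<close>.\<close>

definition el :: "(nat \<times> nat \<times> nat \<Rightarrow> complex) \<Rightarrow> 'a" where
  "el f = (SOME x. x \<in> carrier A \<and> (\<forall>t\<in>J. c x t = f t))"

lemma el_closed: "el f \<in> carrier A"
  and coord_el: "t \<in> J \<Longrightarrow> c (el f) t = f t"
  using someI_ex[of "\<lambda>x. x \<in> carrier A \<and> (\<forall>t\<in>J. c x t = f t)"] coord_surj[of f]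
  by (auto simp: el_def)

lemma coord_zero: "t \<in> J \<Longrightarrow> c \<zero>\<^bsub>A\<^esub> t = 0"
  using coord_add[of "\<zero>\<^bsub>A\<^esub>" "\<zero>\<^bsub>A\<^esub>" t] by simp

lemma smult_in_carrier: "x \<in> carrier A \<Longrightarrow> z \<odot>\<^bsub>A\<^esub> x \<in> carrier A"
  by (rule smult_closed) (auto simp: class_ring_simps)

lemma coord_lincomb:
  assumes "finite S" "S \<subseteq> carrier A" "t \<in> J"
  shows "c (lincomb \<alpha> S) t = (\<Sum>v\<in>S. \<alpha> v * c v t)"
  using assms(1,2)
proof (induction S rule: finite_induct)
  case empty
  then show ?case by (simp add: lincomb_def coord_zero[OF assms(3)])
next
  case (insert v S)
  have cl: "(\<lambda>v. \<alpha> v \<odot>\<^bsub>A\<^esub> v) \<in> S \<rightarrow> carrier A" "\<alpha> v \<odot>\<^bsub>A\<^esub> v \<in> carrier A"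
    using insert.prems by (auto intro: smult_in_carrier)
  have "lincomb \<alpha> (insert v S) = \<alpha> v \<odot>\<^bsub>A\<^esub> v \<oplus>\<^bsub>A\<^esub> lincomb \<alpha> S"
    unfolding lincomb_def using insert.hyps cl by (intro M.finsum_insert) auto
  moreover have "lincomb \<alpha> S \<in> carrier A"
    unfolding lincomb_def using cl by (intro M.finsum_closed) auto
  ultimately show ?case
    using insert assms(3) cl by (simp add: coord_add coord_smult)
qed

text \<open>Associativity is not among the assumptions of the locale; it is inherited from matrix
  multiplication through the coordinates. For the partition algebra this replaces a direct
  verification on diagrams.\<close>

lemma mult_assoc:
  assumes x: "x \<in> carrier A" and y: "y \<in> carrier A" and z: "z \<in> carrier A"
  shows "(x \<otimes>\<^bsub>A\<^esub> y) \<otimes>\<^bsub>A\<^esub> z = x \<otimes>\<^bsub>A\<^esub> (y \<otimes>\<^bsub>A\<^esub> z)"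
proof (rule coord_eqI)
  fix t assume t: "t \<in> J"
  obtain s i j where tt: "t = (s, i, j)" by (rule prod_cases3)
  then have ij: "(s, i, l) \<in> J" "(s, l, j) \<in> J" if "l < d s" for l
    using t that by (auto simp: block_indices_def)
  have "c ((x \<otimes>\<^bsub>A\<^esub> y) \<otimes>\<^bsub>A\<^esub> z) t =
      (\<Sum>l<d s. \<Sum>m<d s. c x (s, i, m) * c y (s, m, l) * c z (s, l, j))"
    using t assms ij unfolding tt by (simp add: coord_mult mult_closed sum_distrib_right)
  also have "\<dots> = (\<Sum>m<d s. \<Sum>l<d s. c x (s, i, m) * c y (s, m, l) * c z (s, l, j))"
    by (rule sum.swap)
  also have "\<dots> = c (x \<otimes>\<^bsub>A\<^esub> (y \<otimes>\<^bsub>A\<^esub> z)) t"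
    using t assms ij unfolding tt
    by (simp add: coord_mult mult_closed sum_distrib_left mult.assoc)
  finally show "c ((x \<otimes>\<^bsub>A\<^esub> y) \<otimes>\<^bsub>A\<^esub> z) t = c (x \<otimes>\<^bsub>A\<^esub> (y \<otimes>\<^bsub>A\<^esub> z)) t" .
qed (use assms mult_closed in auto)

lemma unit_mult:
  assumes x: "x \<in> carrier A"
  shows "\<one>\<^bsub>A\<^esub> \<otimes>\<^bsub>A\<^esub> x = x" and "x \<otimes>\<^bsub>A\<^esub> \<one>\<^bsub>A\<^esub> = x"
proof -
  have "c (\<one>\<^bsub>A\<^esub> \<otimes>\<^bsub>A\<^esub> x) (s, i, j) = c x (s, i, j) \<and> c (x \<otimes>\<^bsub>A\<^esub> \<one>\<^bsub>A\<^esub>) (s, i, j) = c x (s, i, j)"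
    if t: "(s, i, j) \<in> J" for s i j
  proof -
    have ij: "i < d s" "j < d s" "\<And>l. l < d s \<Longrightarrow> (s, i, l) \<in> J \<and> (s, l, j) \<in> J"
      using t by (auto simp: block_indices_def)
    have "c (\<one>\<^bsub>A\<^esub> \<otimes>\<^bsub>A\<^esub> x) (s, i, j) = (\<Sum>l<d s. if l = i then c x (s, i, j) else 0)"
      using t x unit_closed ij(3) by (auto simp: coord_mult coord_unit intro!: sum.cong)
    moreover have "c (x \<otimes>\<^bsub>A\<^esub> \<one>\<^bsub>A\<^esub>) (s, i, j) = (\<Sum>l<d s. if l = j then c x (s, i, j) else 0)"
      using t x unit_closed ij(3) by (auto simp: coord_mult coord_unit intro!: sum.cong)
    ultimately show ?thesis using ij(1,2) by simp
  qed
  then have *: "c (\<one>\<^bsub>A\<^esub> \<otimes>\<^bsub>A\<^esub> x) t = c x t \<and> c (x \<otimes>\<^bsub>A\<^esub> \<one>\<^bsub>A\<^esub>) t = c x t" if "t \<in> J" for t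
    using that by (cases t) auto
  show "\<one>\<^bsub>A\<^esub> \<otimes>\<^bsub>A\<^esub> x = x" "x \<otimes>\<^bsub>A\<^esub> \<one>\<^bsub>A\<^esub> = x"
    using * x unit_closed mult_closed by (auto intro!: coord_eqI)
qed

section \<open>Matrix units and linear functionals\<close>

definition matrix_unit :: "nat \<times> nat \<times> nat \<Rightarrow> 'a" where
  "matrix_unit t = el (\<lambda>u. of_bool (u = t))"

lemma matrix_unit_closed: "matrix_unit t \<in> carrier A"
  by (simp add: matrix_unit_def el_closed)

lemma coord_matrix_unit: "u \<in> J \<Longrightarrow> c (matrix_unit t) u = of_bool (u = t)"
  by (simp add: matrix_unit_def coord_el)

text \<open>Right multiplication by a matrix unit moves column \<open>i\<close> of block
  \<open>s\<close> to column \<open>j\<close> and clears everything else.\<close>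

lemma coord_mult_matrix_unit:
  assumes x: "x \<in> carrier A" and t: "(s, i, j) \<in> J" and u: "(s', i', j') \<in> J"
  shows "c (x \<otimes>\<^bsub>A\<^esub> matrix_unit (s, i, j)) (s', i', j') =
    (if s' = s \<and> j' = j then c x (s, i', i) else 0)"
proof -
  have "c (x \<otimes>\<^bsub>A\<^esub> matrix_unit (s, i, j)) (s', i', j') =
    (\<Sum>l<d s'. if l = i then (if s' = s \<and> j' = j then c x (s, i', i) else 0) else 0)"
    unfolding coord_mult[OF x matrix_unit_closed u] using u
    by (intro sum.cong refl) (auto simp: block_indices_def coord_matrix_unit)
  then show ?thesis using t by (auto simp: block_indices_def)
qed

lemma matrix_unit_mult:
  assumes "(s, i, j) \<in> J" "(s, j', l) \<in> J"
  shows "matrix_unit (s, i, j) \<otimes>\<^bsub>A\<^esub> matrix_unit (s, j', l) =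
    (if j = j' then matrix_unit (s, i, l) else \<zero>\<^bsub>A\<^esub>)"
proof (rule coord_eqI)
  fix u assume u: "u \<in> J"
  obtain s' i' l' where [simp]: "u = (s', i', l')" by (rule prod_cases3)
  have "s' = s \<Longrightarrow> (s, i', j') \<in> J" using u assms by (auto simp: block_indices_def)
  then show "c (matrix_unit (s, i, j) \<otimes>\<^bsub>A\<^esub> matrix_unit (s, j', l)) u =
      c (if j = j' then matrix_unit (s, i, l) else \<zero>\<^bsub>A\<^esub>) u"
    using u assms
    by (auto simp: coord_mult_matrix_unit matrix_unit_closed coord_matrix_unit coord_zero)
qed (auto simp: mult_closed matrix_unit_closed)

lemma linear_expansion:
  fixes L :: "'a \<Rightarrow> complex"
  assumes add: "\<And>x y. x \<in> carrier A \<Longrightarrow> y \<in> carrier A \<Longrightarrow> L (x \<oplus>\<^bsub>A\<^esub> y) = L x + L y"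
    and smult: "\<And>z x. x \<in> carrier A \<Longrightarrow> L (z \<odot>\<^bsub>A\<^esub> x) = z * L x"
    and x: "x \<in> carrier A"
  shows "L x = (\<Sum>t\<in>J. c x t * L (matrix_unit t))"
proof -
  \<comment> \<open>The induction is on a set \<open>S\<close> of indices containing the support of
    \<open>x\<close>; each step splits off the component of \<open>x\<close> at one index.\<close>
  have "L x = (\<Sum>t\<in>S. c x t * L (matrix_unit t))"
    if "finite S" "S \<subseteq> J" "x \<in> carrier A" "\<And>t. t \<in> J - S \<Longrightarrow> c x t = 0" for S x
    using that
  proof (induction S arbitrary: x rule: finite_induct)
    case empty
    then have "x = \<zero>\<^bsub>A\<^esub>" by (intro coord_eqI) (auto simp: coord_zero)
    then show ?case using add[of "\<zero>\<^bsub>A\<^esub>" "\<zero>\<^bsub>A\<^esub>"] by simp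
  next
    case (insert u S)
    define y where "y = el (\<lambda>t. if t = u then 0 else c x t)"
    have y: "y \<in> carrier A" "\<And>t. t \<in> J \<Longrightarrow> c y t = (if t = u then 0 else c x t)"
      by (auto simp: y_def el_closed coord_el)
    have cl: "c x u \<odot>\<^bsub>A\<^esub> matrix_unit u \<in> carrier A"
      by (simp add: smult_in_carrier matrix_unit_closed)
    have "x = y \<oplus>\<^bsub>A\<^esub> c x u \<odot>\<^bsub>A\<^esub> matrix_unit u"
      using insert.prems y cl
      by (intro coord_eqI)
        (auto simp: coord_add coord_smult matrix_unit_closed coord_matrix_unit)
    then have "L x = L y + c x u * L (matrix_unit u)"
      using add[OF y(1) cl] smult[OF matrix_unit_closed] by metis
    also have "L y = (\<Sum>t\<in>S. c y t * L (matrix_unit t))"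
      using insert.prems y by (intro insert.IH) auto
    also have "\<dots> = (\<Sum>t\<in>S. c x t * L (matrix_unit t))"
    proof (intro sum.cong refl)
      fix t assume "t \<in> S"
      then have "c y t = c x t" using insert.hyps insert.prems(1) y(2)[of t] by auto
      then show "c y t * L (matrix_unit t) = c x t * L (matrix_unit t)" by simp
    qed
    finally show ?case using insert.hyps by simp
  qed
  then show ?thesis using x finite_block_indices by blast
qed

text \<open>An off-diagonal matrix unit squares to zero, so a character kills it, and it also kills the
  diagonal units of every block of size at least two.\<close>

lemma character_block:
  fixes \<chi> :: "'a \<Rightarrow> complex"
  assumes add: "\<And>x y. x \<in> carrier A \<Longrightarrow> y \<in> carrier A \<Longrightarrow> \<chi> (x \<oplus>\<^bsub>A\<^esub> y) = \<chi> x + \<chi> y"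
    and smult: "\<And>z x. x \<in> carrier A \<Longrightarrow> \<chi> (z \<odot>\<^bsub>A\<^esub> x) = z * \<chi> x"
    and mult: "\<And>x y. x \<in> carrier A \<Longrightarrow> y \<in> carrier A \<Longrightarrow> \<chi> (x \<otimes>\<^bsub>A\<^esub> y) = \<chi> x * \<chi> y"
    and unit: "\<chi> \<one>\<^bsub>A\<^esub> = 1"
  shows "\<exists>s<r. d s = 1 \<and> (\<forall>x\<in>carrier A. \<chi> x = c x (s, 0, 0))"
proof -
  have zero: "\<chi> \<zero>\<^bsub>A\<^esub> = 0" using add[of "\<zero>\<^bsub>A\<^esub>" "\<zero>\<^bsub>A\<^esub>"] by simp
  \<comment> \<open>The identity is the sum of the diagonal matrix units, so \<open>\<chi>\<close>
    is nonzero on one of them.\<close>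
  have "(\<Sum>t\<in>J. c \<one>\<^bsub>A\<^esub> t * \<chi> (matrix_unit t)) \<noteq> 0"
    using linear_expansion[OF add smult unit_closed] unit by simp
  then obtain t where t: "t \<in> J" "c \<one>\<^bsub>A\<^esub> t * \<chi> (matrix_unit t) \<noteq> 0"
    by (meson sum.not_neutral_contains_not_neutral)
  then obtain s i where si: "t = (s, i, i)" "(s, i, i) \<in> J" "\<chi> (matrix_unit (s, i, i)) \<noteq> 0"
    by (cases t) (auto simp: coord_unit split: if_splits)
  have bounds: "s < r" "i < d s" using si(2) by (auto simp: block_indices_def)
  have ds: "d s = 1"
  proof (rule ccontr)
    assume "d s \<noteq> 1"
    define j where "j = (if i = 0 then 1 else 0 :: nat)"
    have j: "j < d s" "j \<noteq> i" using bounds \<open>d s \<noteq> 1\<close> by (auto simp: j_def)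
    have idx: "(s, i, j) \<in> J" "(s, j, i) \<in> J" using bounds j by (auto simp: block_indices_def)
    have "\<chi> (matrix_unit (s, i, i)) = \<chi> (matrix_unit (s, i, j)) * \<chi> (matrix_unit (s, j, i))"
      using matrix_unit_mult[OF idx] mult[OF matrix_unit_closed matrix_unit_closed] by metis
    moreover have "\<chi> (matrix_unit (s, i, j)) * \<chi> (matrix_unit (s, i, j)) = 0"
      using matrix_unit_mult[OF idx(1) idx(1)] j(2) zero
        mult[OF matrix_unit_closed matrix_unit_closed] by metis
    ultimately show False using si(3) by simp
  qed
  then have i: "i = 0" using bounds by simp
  define e where "e = matrix_unit (s, 0, 0)"
  have e: "e \<in> carrier A" "(s, 0, 0) \<in> J" "\<chi> e \<noteq> 0"
    using si i by (auto simp: e_def matrix_unit_closed)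
  have "\<chi> x = c x (s, 0, 0)" if x: "x \<in> carrier A" for x
  proof -
    \<comment> \<open>A block of size one is a one-dimensional ideal, so \<open>x\<close> acts on
      its unit \<open>e\<close> by a scalar. Applying \<open>\<chi>\<close> and cancelling the
      nonzero \<open>\<chi> e\<close> identifies \<open>\<chi>\<close> with that coordinate.\<close>
    have "x \<otimes>\<^bsub>A\<^esub> e = c x (s, 0, 0) \<odot>\<^bsub>A\<^esub> e"
    proof (rule coord_eqI)
      fix u assume u: "u \<in> J"
      obtain s' i' j' where [simp]: "u = (s', i', j')" by (rule prod_cases3)
      have "s' = s \<Longrightarrow> i' = 0 \<and> j' = 0" using u ds by (auto simp: block_indices_def)
      then show "c (x \<otimes>\<^bsub>A\<^esub> e) u = c (c x (s, 0, 0) \<odot>\<^bsub>A\<^esub> e) u"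
        using u x e by (auto simp: e_def coord_mult_matrix_unit coord_smult coord_matrix_unit)
    qed (use x e in \<open>auto simp: mult_closed smult_in_carrier\<close>)
    then have "\<chi> x * \<chi> e = c x (s, 0, 0) * \<chi> e"
      using mult[OF x e(1)] smult[OF e(1)] by metis
    then show ?thesis using e(3) by simp
  qed
  then show ?thesis using bounds ds by blast
qed

text \<open>The hypotheses say that the algebra has dimension two, and the only way to write 2 as a
  sum of positive squares is 1 + 1. The argument is made in coordinates instead of through
  dimensions.\<close>

lemma two_blocks_of_dim_two:
  assumes v: "v \<in> carrier A" and nv: "\<And>z. v \<noteq> z \<odot>\<^bsub>A\<^esub> \<one>\<^bsub>A\<^esub>"
    and span: "\<And>x. x \<in> carrier A \<Longrightarrow> \<exists>z w. x = z \<odot>\<^bsub>A\<^esub> \<one>\<^bsub>A\<^esub> \<oplus>\<^bsub>A\<^esub> w \<odot>\<^bsub>A\<^esub> v"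
  shows "\<exists>a b. a < r \<and> b < r \<and> a \<noteq> b \<and> d a = 1 \<and> d b = 1"
proof -
  have coord_span: "\<exists>z w. \<forall>s i j. (s, i, j) \<in> J \<longrightarrow> c x (s, i, j) = z * of_bool (i = j) + w * c v (s, i, j)"
    if x: "x \<in> carrier A" for x
  proof -
    obtain z w where x_eq: "x = z \<odot>\<^bsub>A\<^esub> \<one>\<^bsub>A\<^esub> \<oplus>\<^bsub>A\<^esub> w \<odot>\<^bsub>A\<^esub> v" using span[OF x] by blast
    have "c x (s, i, j) = z * of_bool (i = j) + w * c v (s, i, j)" if "(s, i, j) \<in> J" for s i j
      unfolding x_eq
      using that v unit_closed by (simp add: coord_add coord_smult coord_unit smult_in_carrier)
    then show ?thesis by blast
  qed
  have d1: "d s = 1" if s: "s < r" for s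
  proof (rule ccontr)
    assume "d s \<noteq> 1"
    then have "d s \<ge> 2" using d_pos[OF s] by simp
    then have idx: "(s, 0, 1) \<in> J" "(s, 1, 0) \<in> J" using s by (auto simp: block_indices_def)
    obtain z w where 1: "\<And>s' i j. (s', i, j) \<in> J \<Longrightarrow>
      c (matrix_unit (s, 0, 1)) (s', i, j) = z * of_bool (i = j) + w * c v (s', i, j)"
      using coord_span[OF matrix_unit_closed] by blast
    obtain z' w' where 2: "\<And>s' i j. (s', i, j) \<in> J \<Longrightarrow>
      c (matrix_unit (s, 1, 0)) (s', i, j) = z' * of_bool (i = j) + w' * c v (s', i, j)"
      using coord_span[OF matrix_unit_closed] by blast
    \<comment> \<open>The identity has no off-diagonal entries, so the entries at (0,1) and (1,0) of
      every element are a common multiple of those of \<open>v\<close>. The two opposite matrix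
      units cannot both satisfy this.\<close>
    have "w * c v (s, 0, 1) = 1" using 1[OF idx(1)] idx by (simp add: coord_matrix_unit)
    moreover have "w' * c v (s, 0, 1) = 0" "w' * c v (s, 1, 0) = 1"
      using 2[OF idx(1)] 2[OF idx(2)] idx by (simp_all add: coord_matrix_unit)
    ultimately show False by auto
  qed
  have "r \<ge> 2"
  proof (rule ccontr)
    assume "\<not> r \<ge> 2"
    have J: "t = (0, 0, 0)" if "t \<in> J" for t
    proof -
      obtain s i j where tt: "t = (s, i, j)" "s < r" "i < d s" "j < d s"
        using \<open>t \<in> J\<close> by (auto simp: block_indices_def)
      then show ?thesis using \<open>\<not> r \<ge> 2\<close> d1[of s] by auto
    qed
    \<comment> \<open>With at most one block, necessarily of size one, every element is a scalar
      multiple of the identity.\<close>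
    have "v = c v (0, 0, 0) \<odot>\<^bsub>A\<^esub> \<one>\<^bsub>A\<^esub>"
    proof (rule coord_eqI)
      fix t assume t: "t \<in> J"
      then show "c v t = c (c v (0, 0, 0) \<odot>\<^bsub>A\<^esub> \<one>\<^bsub>A\<^esub>) t"
        using J[OF t] coord_unit[of 0 0 0] unit_closed by (simp add: coord_smult)
    qed (use v unit_closed smult_in_carrier in auto)
    then show False using nv by blast
  qed
  then show ?thesis using d1[of 0] d1[of 1] by (intro exI[of _ 0] exI[of _ 1]) auto
qed

text \<open>Since \<open>\<epsilon>\<^sub>a\<close> is idempotent and annihilates all other blocks,
  the product of \<open>\<epsilon>\<^sub>a + E\<^sub>t\<close> and
  \<open>\<epsilon>\<^sub>a + E\<^sub>u\<close> is
  \<open>\<epsilon>\<^sub>a + E\<^sub>t E\<^sub>u\<close>. The family is indexed by \<open>J\<close>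
  itself, so it has as many members as there are matrix units: index \<open>?a\<close> carries
  \<open>\<epsilon>\<^sub>a\<close> and index \<open>?b\<close> carries the identity.\<close>

lemma monoid_basis_of_two_blocks:
  assumes ab: "a < r" "b < r" "a \<noteq> b" and da: "d a = 1" and db: "d b = 1"
  shows "\<exists>M. basis M \<and> (\<exists>e. monoid \<lparr>carrier = M, mult = mult A, one = e\<rparr>)"
proof -
  let ?a = "(a, 0, 0) :: nat \<times> nat \<times> nat" and ?b = "(b, 0, 0) :: nat \<times> nat \<times> nat"
  define diag where "diag u \<longleftrightarrow> fst (snd u) = snd (snd u)" for u :: "nat \<times> nat \<times> nat"
  define f where "f t u = (if t = ?b then of_bool (diag u) else of_bool (u = ?a \<or> u = t) :: complex)"
    for t u
  define m where "m t = el (f t)" for t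
    \<comment> \<open>\<open>m ?a = \<epsilon>\<^sub>a\<close>, \<open>m ?b = \<one>\<close>, and \<open>m t = \<epsilon>\<^sub>a + E\<^sub>t\<close> otherwise\<close>
  have aJ: "?a \<in> J" and bJ: "?b \<in> J" and neq: "?a \<noteq> ?b"
    using ab da db by (auto simp: block_indices_def)
  have block_a: "t = ?a" if "t \<in> J" "fst t = a" for t
    using that da by (cases t) (auto simp: block_indices_def)
  have block_b: "t = ?b" if "t \<in> J" "fst t = b" for t
    using that db by (cases t) (auto simp: block_indices_def)
  have m_cl: "m t \<in> carrier A" for t by (simp add: m_def el_closed)
  have m_co: "c (m t) u = f t u" if "u \<in> J" for t u using that by (simp add: m_def coord_el)
  have f_a: "f t ?a = 1" for t by (simp add: f_def diag_def)
  have f_b: "f t ?b = of_bool (t = ?b)" for t using neq by (auto simp: f_def diag_def)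
  have inj: "inj_on m J"
  proof (rule inj_onI)
    fix t u assume tu: "t \<in> J" "u \<in> J" "m t = m u"
    have f_eq: "f t x = f u x" if "x \<in> J" for x using m_co[OF that] tu(3) by metis
    have "t = ?b \<longleftrightarrow> u = ?b" using f_eq[OF bJ] by (auto simp: f_b split: if_splits)
    moreover have "t = u" if "t \<noteq> ?b" "u \<noteq> ?b"
      using f_eq[OF tu(1)] f_eq[OF tu(2)] that by (auto simp: f_def split: if_splits)
    ultimately show "t = u" by blast
  qed
  have m_one: "m ?b = \<one>\<^bsub>A\<^esub>"
    using m_cl unit_closed
    by (intro coord_eqI) (auto simp: m_co coord_unit f_def diag_def)
  have m_mult: "m t \<otimes>\<^bsub>A\<^esub> m t' \<in> m ` J" if t: "t \<in> J" "t' \<in> J" for t t'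
  proof (cases "t = ?b \<or> t' = ?b")
    case True
    then have "m t \<otimes>\<^bsub>A\<^esub> m t' = m t' \<or> m t \<otimes>\<^bsub>A\<^esub> m t' = m t"
      using m_one unit_mult[OF m_cl] by metis
    then show ?thesis using t by auto
  next
    case False
    obtain s i j where tt: "t = (s, i, j)" by (rule prod_cases3)
    obtain s' i' j' where tt': "t' = (s', i', j')" by (rule prod_cases3)
    \<comment> \<open>The index of the product. The default \<open>?a\<close> covers a vanishing
      product of matrix units, where only \<open>\<epsilon>\<^sub>a\<close> remains.\<close>
    define u where "u = (if s = s' \<and> j = i' then (s, i, j') else ?a)"
    have uJ: "u \<in> J" using t aJ by (auto simp: u_def tt tt' block_indices_def)
    have ub: "u \<noteq> ?b" using False block_b[OF t(1)] neq by (auto simp: u_def tt)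
    have "m t \<otimes>\<^bsub>A\<^esub> m t' = m u"
    proof (rule coord_eqI)
      fix x assume x: "x \<in> J"
      obtain p k l where xx: "x = (p, k, l)" by (rule prod_cases3)
      have kl: "(p, k, q) \<in> J" "(p, q, l) \<in> J" if "q < d p" for q
        using x that by (auto simp: xx block_indices_def)
      have prod: "c (m t \<otimes>\<^bsub>A\<^esub> m t') x = (\<Sum>q<d p. f t (p, k, q) * f t' (p, q, l))"
        using x kl by (simp add: xx coord_mult m_cl m_co)
      show "c (m t \<otimes>\<^bsub>A\<^esub> m t') x = c (m u) x"
      proof (cases "p = a")
        case True
        then have "x = ?a" using block_a[OF x] by (simp add: xx)
        then show ?thesis using prod x by (simp add: xx da f_a m_co)
      next
        case p: False
        \<comment> \<open>Away from block \<open>a\<close> both factors are plain matrix units, so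
          only the summand \<open>q = j\<close> can be nonzero.\<close>
        have "(\<Sum>q<d p. f t (p, k, q) * f t' (p, q, l)) =
          (\<Sum>q<d p. if q = j then of_bool (p = s \<and> k = i \<and> p = s' \<and> j = i' \<and> l = j') else 0)"
          using False p by (intro sum.cong refl) (auto simp: f_def tt tt')
        also have "\<dots> = f u x"
          using t p ub by (auto simp: f_def u_def xx tt tt' block_indices_def)
        finally show ?thesis using prod x by (simp add: m_co)
      qed
    qed (auto simp: m_cl mult_closed)
    then show ?thesis using uJ by blast
  qed
  have "monoid \<lparr>carrier = m ` J, mult = mult A, one = \<one>\<^bsub>A\<^esub>\<rparr>"
  proof (rule monoidI)
    show "\<one>\<^bsub>\<lparr>carrier = m ` J, mult = mult A, one = \<one>\<^bsub>A\<^esub>\<rparr>\<^esub> \<in>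
        carrier \<lparr>carrier = m ` J, mult = mult A, one = \<one>\<^bsub>A\<^esub>\<rparr>"
      using bJ m_one by (auto intro!: image_eqI[of _ m ?b])
  qed (use m_mult mult_assoc unit_mult m_cl in auto)
  moreover have "basis (m ` J)"
  proof -
    have fin: "finite J" by (rule finite_block_indices)
    \<comment> \<open>The linear system for the coefficients is triangular: the
      \<open>?b\<close>-coordinate sees only the identity, every other coordinate except
      \<open>?a\<close> sees its own vector and, on the diagonal, the identity, and the
      \<open>?a\<close>-coordinate sees all vectors with coefficient 1.\<close>
    have sys: "c (lincomb \<alpha> (m ` J)) u =
      (if u = ?a then \<Sum>t\<in>J. \<alpha> (m t)
       else if u = ?b then \<alpha> (m ?b) else \<alpha> (m u) + of_bool (diag u) * \<alpha> (m ?b))"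
      if u: "u \<in> J" for \<alpha> u
    proof -
      have eq: "c (lincomb \<alpha> (m ` J)) u = (\<Sum>t\<in>J. \<alpha> (m t) * f t u)"
        using fin m_cl u inj by (simp add: coord_lincomb image_subset_iff sum.reindex m_co)
      show ?thesis
      proof (cases "u = ?a")
        case True
        then show ?thesis using eq by (simp add: f_a)
      next
        case False
        have "(\<Sum>t\<in>J. \<alpha> (m t) * f t u) = \<alpha> (m ?b) * f ?b u + (\<Sum>t\<in>J - {?b}. \<alpha> (m t) * f t u)"
          using fin bJ by (rule sum.remove)
        also have "(\<Sum>t\<in>J - {?b}. \<alpha> (m t) * f t u) = (\<Sum>t\<in>J - {?b}. if t = u then \<alpha> (m u) else 0)"
          using False by (intro sum.cong refl) (auto simp: f_def)
        also have "\<dots> = (if u = ?b then 0 else \<alpha> (m u))" using fin u by simp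
        finally show ?thesis using eq False by (auto simp: f_def diag_def)
      qed
    qed
    have "\<exists>!\<alpha>. \<alpha> \<in> m ` J \<rightarrow>\<^sub>E carrier (class_ring :: complex ring) \<and> lincomb \<alpha> (m ` J) = v"
      if v: "v \<in> carrier A" for v
    proof -
      \<comment> \<open>Solution of the system by substitution: the coefficient of the identity is
        \<open>c v ?b\<close>, it is subtracted at the other diagonal positions, and the coefficient
        of \<open>\<epsilon>\<^sub>a\<close> is what is then missing from the total at
        \<open>?a\<close>.\<close>
      define g0 where "g0 u = c v u - of_bool (u \<noteq> ?b \<and> diag u) * c v ?b" for u
      define g where "g u = (if u = ?a then c v ?a - (\<Sum>t\<in>J - {?a}. g0 t) else g0 u)" for u
      have lc_cl: "lincomb \<alpha> (m ` J) \<in> carrier A" for \<alpha>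
        by (rule lincomb_closed) (auto simp: m_cl class_ring_simps)
      have iff: "lincomb \<alpha> (m ` J) = v \<longleftrightarrow> (\<forall>u\<in>J. \<alpha> (m u) = g u)" for \<alpha>
      proof
        assume "lincomb \<alpha> (m ` J) = v"
        then have co: "c v u = (if u = ?a then \<Sum>t\<in>J. \<alpha> (m t)
          else if u = ?b then \<alpha> (m ?b) else \<alpha> (m u) + of_bool (diag u) * \<alpha> (m ?b))"
          if "u \<in> J" for u using sys[OF that, of \<alpha>] by simp
        have g0: "\<alpha> (m u) = g0 u" if "u \<in> J" "u \<noteq> ?a" for u
          using co[OF that(1)] co[OF bJ] that(2) neq by (simp add: g0_def)
        have "c v ?a = \<alpha> (m ?a) + (\<Sum>t\<in>J - {?a}. \<alpha> (m t))"
          using co[OF aJ] sum.remove[OF fin aJ, of "\<lambda>t. \<alpha> (m t)"] by simp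
        also have "(\<Sum>t\<in>J - {?a}. \<alpha> (m t)) = (\<Sum>t\<in>J - {?a}. g0 t)"
          using g0 by (intro sum.cong) auto
        finally have "\<alpha> (m ?a) = g ?a" by (simp add: g_def)
        then show "\<forall>u\<in>J. \<alpha> (m u) = g u" using g0 by (auto simp: g_def)
      next
        assume \<alpha>: "\<forall>u\<in>J. \<alpha> (m u) = g u"
        have "(\<Sum>t\<in>J. \<alpha> (m t)) = g ?a + (\<Sum>t\<in>J - {?a}. g t)"
          using \<alpha> sum.remove[OF fin aJ, of g] by simp
        also have "(\<Sum>t\<in>J - {?a}. g t) = (\<Sum>t\<in>J - {?a}. g0 t)"
          by (intro sum.cong) (auto simp: g_def)
        finally have "(\<Sum>t\<in>J. \<alpha> (m t)) = c v ?a" by (simp add: g_def)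
        then show "lincomb \<alpha> (m ` J) = v"
          using v lc_cl \<alpha> bJ neq by (intro coord_eqI) (auto simp: sys g_def g0_def)
      qed
      show ?thesis
      proof (rule ex1I[of _ "\<lambda>x\<in>m ` J. g (inv_into J m x)"])
        show "(\<lambda>x\<in>m ` J. g (inv_into J m x)) \<in> m ` J \<rightarrow>\<^sub>E carrier (class_ring :: complex ring) \<and>
            lincomb (\<lambda>x\<in>m ` J. g (inv_into J m x)) (m ` J) = v"
          unfolding iff using inj by (auto simp: class_ring_simps)
      next
        fix \<alpha> assume "\<alpha> \<in> m ` J \<rightarrow>\<^sub>E carrier (class_ring :: complex ring) \<and> lincomb \<alpha> (m ` J) = v"
        then show "\<alpha> = (\<lambda>x\<in>m ` J. g (inv_into J m x))"
          unfolding iff using inj by (intro extensionalityI[of _ "m ` J"]) (auto simp: PiE_def)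
      qed
    qed
    then show ?thesis using fin m_cl by (subst basis_criterion) auto
  qed
  ultimately show ?thesis by blast
qed

end

text \<open>The coordinates are the matrix entries of the image under the isomorphism: being a
  homomorphism gives the algebraic laws, injectivity gives \<open>coord_eqI\<close>, and
  surjectivity gives \<open>coord_surj\<close>.\<close>

lemma semisimple_matrix_blocks:
  fixes A :: "(complex, 'a) module"
  assumes vs: "vectorspace class_ring A"
    and mult_closed: "\<And>x y. x \<in> carrier A \<Longrightarrow> y \<in> carrier A \<Longrightarrow> x \<otimes>\<^bsub>A\<^esub> y \<in> carrier A"
    and unit_closed: "\<one>\<^bsub>A\<^esub> \<in> carrier A"
    and ss: "semisimple_algebra A"
  obtains r d c where "matrix_blocks A r d c"
proof -
  obtain r :: nat and d :: "nat \<Rightarrow> nat" and h where d: "\<forall>i<r. d i > 0"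
    and h: "h \<in> algebra_iso A
      (direct_sum_algebra {..<r} (\<lambda>i. module_mat TYPE(complex) (d i) (d i)))"
    (is "_ \<in> algebra_iso A ?B") using ss unfolding semisimple_algebra_def by blast
  note B = direct_sum_algebra_def module_mat_simps
  have ring: "h \<in> Ring.ring_hom A ?B" and bij: "bij_betw h (carrier A) (carrier ?B)"
    and mod: "h \<in> LinearCombinations.module_hom class_ring A ?B"
    using h by (auto simp: algebra_iso_def ring_iso_def)
  have h_cl: "h x s \<in> carrier_mat (d s) (d s)" if "x \<in> carrier A" "s < r" for x s
    using bij_betwE[OF bij] that by (auto simp: B)
  have h_dim: "dim_row (h x s) = d s" "dim_col (h x s) = d s" if "x \<in> carrier A" "s < r" for x s
    using h_cl[OF that] by auto
  have h_ext: "h x \<in> extensional {..<r}" if "x \<in> carrier A" for x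
    using bij_betwE[OF bij] that by (auto simp: B PiE_def)
  have h_add: "h (x \<oplus>\<^bsub>A\<^esub> y) s = h x s + h y s" if "x \<in> carrier A" "y \<in> carrier A" "s < r" for x y s
    using Ring.ring_hom_add[OF ring that(1,2)] that(3) by (simp add: B)
  have h_mult: "h (x \<otimes>\<^bsub>A\<^esub> y) s = h x s * h y s" if "x \<in> carrier A" "y \<in> carrier A" "s < r" for x y s
    using Ring.ring_hom_mult[OF ring that(1,2)] that(3) by (simp add: B)
  have h_smult: "h (z \<odot>\<^bsub>A\<^esub> x) s = z \<cdot>\<^sub>m h x s" if "x \<in> carrier A" "s < r" for x z s
    using LinearCombinations.module_hom_smult[OF mod _ that(1), of z] that(2)
    by (simp add: B class_ring_simps)
  have h_one: "h \<one>\<^bsub>A\<^esub> s = 1\<^sub>m (d s)" if "s < r" for s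
    using Ring.ring_hom_one[OF ring] that by (simp add: B)
  let ?c = "\<lambda>x (s, i, j). h x s $$ (i, j)"
  have "matrix_blocks A r d ?c"
  proof (intro matrix_blocks.intro[OF vs] matrix_blocks_axioms.intro)
    show "?c (x \<oplus>\<^bsub>A\<^esub> y) t = ?c x t + ?c y t"
      if "x \<in> carrier A" "y \<in> carrier A" "t \<in> block_indices r d" for x y t
      using that by (auto simp: block_indices_def h_add h_dim)
    show "?c (z \<odot>\<^bsub>A\<^esub> x) t = z * ?c x t" if "x \<in> carrier A" "t \<in> block_indices r d" for x z t
      using that by (auto simp: block_indices_def h_smult h_dim)
    show "?c (x \<otimes>\<^bsub>A\<^esub> y) (s, i, j) = (\<Sum>l<d s. ?c x (s, i, l) * ?c y (s, l, j))"
      if "x \<in> carrier A" "y \<in> carrier A" "(s, i, j) \<in> block_indices r d" for x y s i j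
      using that
      by (auto simp: block_indices_def h_mult h_dim scalar_prod_def lessThan_atLeast0)
    show "?c \<one>\<^bsub>A\<^esub> (s, i, j) = of_bool (i = j)" if "(s, i, j) \<in> block_indices r d" for s i j
      using that by (auto simp: block_indices_def h_one)
    show "x = y" if x: "x \<in> carrier A" and y: "y \<in> carrier A"
      and eq: "\<And>t. t \<in> block_indices r d \<Longrightarrow> ?c x t = ?c y t" for x y
    proof -
      have "h x s = h y s" if s: "s < r" for s
      proof (rule eq_matI)
        fix i j assume "i < dim_row (h y s)" "j < dim_col (h y s)"
        then have "(s, i, j) \<in> block_indices r d"
          using h_cl[OF y s] s by (auto simp: block_indices_def)
        then show "h x s $$ (i, j) = h y s $$ (i, j)" using eq by fastforce
      qed (use h_cl[OF x s] h_cl[OF y s] in auto)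
      \<comment> \<open>Elements of the direct sum are extensional functions, so agreement on the
        blocks below \<open>r\<close> is enough.\<close>
      then have "h x = h y"
        using h_ext x y by (intro extensionalityI[of _ "{..<r}"]) auto
      then show ?thesis using bij x y by (auto simp: bij_betw_def dest: inj_onD)
    qed
    show "\<exists>x\<in>carrier A. \<forall>t\<in>block_indices r d. ?c x t = f t" for f
    proof -
      let ?y = "\<lambda>s\<in>{..<r}. mat (d s) (d s) (\<lambda>(i, j). f (s, i, j))"
      have "?y \<in> carrier ?B" by (auto simp: B)
      then have "?y \<in> h ` carrier A" by (simp only: bij_betw_imp_surj_on[OF bij])
      then obtain x where y: "?y = h x" and x: "x \<in> carrier A" by (rule imageE)
      have "?c x t = f t" if "t \<in> block_indices r d" for t
        using that by (auto simp: block_indices_def simp flip: y)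
      then show ?thesis using x by blast
    qed
  qed (use d mult_closed unit_closed in auto)
  then show ?thesis by (rule that)
qed


section \<open>Blocks of size one in the partition algebra\<close>

lemma diagrams_one: "diagrams 1 = {diagram_id 1, {{Inl 1}, {Inr 1}}}"
proof -
  have V: "{1..1} <+> {1..1} = {Inl (1::nat), Inr (1::nat)}" by auto
  have id: "diagram_id 1 = {{Inl 1, Inr 1}}" by (auto simp: diagram_id_def)
  have "p = {{Inl 1, Inr 1}} \<or> p = {{Inl 1}, {Inr 1}}"
    if p: "partition_on {Inl (1::nat), Inr (1::nat)} p" for p
  proof -
    have sub: "p \<subseteq> {{Inl 1}, {Inr 1}, {Inl 1, Inr 1}}"
    proof
      fix B assume "B \<in> p"
      then have "B \<subseteq> {Inl 1, Inr 1}" "B \<noteq> {}" using p by (auto simp: partition_on_def)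
      then show "B \<in> {{Inl 1}, {Inr 1}, {Inl 1, Inr 1}}" by blast
    qed
    have un: "\<Union>p = {Inl 1, Inr 1}" using p by (simp add: partition_on_def)
    have dis: "B = C" if "B \<in> p" "C \<in> p" "x \<in> B" "x \<in> C" for B C x
      using p that by (metis partition_onD2 disjointD Int_iff empty_iff)
    show ?thesis
    proof (cases "{Inl 1, Inr 1} \<in> p")
      case True
      have "B = {Inl 1, Inr 1}" if "B \<in> p" for B
        using dis[OF that True] sub that by blast
      then show ?thesis using True by blast
    next
      case False
      then have "p \<subseteq> {{Inl 1}, {Inr 1}}" using sub by blast
      moreover have "{Inl 1} \<in> p" "{Inr 1} \<in> p" using un calculation by blast+
      ultimately show ?thesis by blast
    qed
  qed
  moreover have "partition_on {Inl (1::nat), Inr (1::nat)} {{Inl 1}, {Inr 1}}"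
    by (auto simp: partition_on_def disjoint_def)
  ultimately show ?thesis
    using diagram_id_in_diagrams[of 1] unfolding diagrams_def V id by blast
qed

lemma partition_algebra_two_blocks_one:
  assumes "matrix_blocks (partition_algebra 1 n) r d c"
  shows "\<exists>a b. a < r \<and> b < r \<and> a \<noteq> b \<and> d a = 1 \<and> d b = 1"
proof -
  interpret matrix_blocks "partition_algebra 1 n" r d c by (rule assms)
  let ?A = "partition_algebra 1 n" and ?q = "{{Inl 1}, {Inr 1}} :: diagram"
  have ne: "?q \<noteq> diagram_id 1" by (auto simp: diagram_id_def)
  have one: "\<one>\<^bsub>?A\<^esub> = basis_vec (diagram_id 1)" by (simp add: partition_algebra_def)
  show ?thesis
  proof (rule two_blocks_of_dim_two[of "basis_vec ?q"])
    have "?q \<in> diagrams 1" unfolding diagrams_one by blast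
    then show "basis_vec ?q \<in> carrier ?A"
      by (auto simp: partition_algebra_def basis_vec_def)
    show "basis_vec ?q \<noteq> z \<odot>\<^bsub>?A\<^esub> \<one>\<^bsub>?A\<^esub>" for z
    proof
      assume "basis_vec ?q = z \<odot>\<^bsub>?A\<^esub> \<one>\<^bsub>?A\<^esub>"
      then have "basis_vec ?q ?q = z * basis_vec (diagram_id 1) ?q"
        unfolding one by (simp add: partition_algebra_def)
      then show False using ne by (simp add: basis_vec_def)
    qed
    show "\<exists>z w. x = z \<odot>\<^bsub>?A\<^esub> \<one>\<^bsub>?A\<^esub> \<oplus>\<^bsub>?A\<^esub> w \<odot>\<^bsub>?A\<^esub> basis_vec ?q"
      if x: "x \<in> carrier ?A" for x
    \<comment> \<open>The witnesses are left schematic; the final \<open>show\<close> instantiates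
      them with the coefficients of \<open>x\<close> at the two diagrams.\<close>
    proof (intro exI ext)
      fix p
      have "x p = 0" if "p \<noteq> diagram_id 1" "p \<noteq> ?q"
      proof -
        have "p \<notin> diagrams 1" unfolding diagrams_one using that by blast
        then show ?thesis using x by (simp add: partition_algebra_def)
      qed
      then show "x p = (x (diagram_id 1) \<odot>\<^bsub>?A\<^esub> \<one>\<^bsub>?A\<^esub> \<oplus>\<^bsub>?A\<^esub> x ?q \<odot>\<^bsub>?A\<^esub> basis_vec ?q) p"
        using ne unfolding one by (simp add: partition_algebra_def basis_vec_def)
    qed
  qed
qed

lemma partition_algebra_two_blocks:
  assumes "matrix_blocks (partition_algebra k n) r d c" and k: "k \<ge> 2"
  shows "\<exists>a b. a < r \<and> b < r \<and> a \<noteq> b \<and> d a = 1 \<and> d b = 1"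
proof -
  interpret matrix_blocks "partition_algebra k n" r d c by (rule assms)
  let ?A = "partition_algebra k n" and ?sgn = "\<lambda>s. of_int (sign s) :: complex"
  have char: "\<exists>a<r. d a = 1 \<and> (\<forall>x\<in>carrier ?A. perm_character k e x = c x (a, 0, 0))"
    if e: "\<And>s t. s permutes {1..k} \<Longrightarrow> t permutes {1..k} \<Longrightarrow> e (t \<circ> s) = e s * e t"
      and e1: "e id = 1" for e
  proof (rule character_block)
    show "perm_character k e \<one>\<^bsub>?A\<^esub> = 1"
      using perm_character_basis_vec[of id k e] e1 permutes_id
      by (simp add: partition_algebra_def perm_diagram_id)
    show "perm_character k e (x \<otimes>\<^bsub>?A\<^esub> y) = perm_character k e x * perm_character k e y" for x y
      using e by (rule perm_character_mult)
  qed (simp_all add: perm_character_def partition_algebra_def algebra_simps sum.distrib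
      sum_distrib_left)
  have perm: "permutation s" if "s permutes {1..k}" for s
    using that permutation_permutes by blast
  obtain a where a: "a < r" "d a = 1"
    "\<And>x. x \<in> carrier ?A \<Longrightarrow> perm_character k (\<lambda>_. 1) x = c x (a, 0, 0)"
    using char[of "\<lambda>_. 1"] by auto
  obtain b where b: "b < r" "d b = 1"
    "\<And>x. x \<in> carrier ?A \<Longrightarrow> perm_character k ?sgn x = c x (b, 0, 0)"
    using char[of ?sgn] perm by (auto simp: sign_compose)
  \<comment> \<open>A transposition exists because \<open>k\<close> is at least 2. The trivial
    character takes the value 1 on it and the sign character -1, so the two characters cannot come
    from the same block.\<close>
  let ?t = "Transposition.transpose 1 2 :: nat \<Rightarrow> nat"
  have t: "?t permutes {1..k}" using k by (intro permutes_swap_id) auto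
  have "basis_vec (perm_diagram k ?t) \<in> carrier ?A"
    using perm_diagram_in_diagrams[OF t] by (auto simp: partition_algebra_def basis_vec_def)
  then have "c (basis_vec (perm_diagram k ?t)) (a, 0, 0) \<noteq> c (basis_vec (perm_diagram k ?t)) (b, 0, 0)"
    using a(3)[symmetric] b(3)[symmetric] perm_character_basis_vec[OF t]
    by (simp add: sign_swap_id)
  then have "a \<noteq> b" by auto
  then show ?thesis using a b by blast
qed

theorem theorem3:
  fixes k :: nat and n :: complex
  assumes "k \<ge> 1"
    and "semisimple_algebra (partition_algebra k n)"
  shows "\<exists>M. vectorspace.basis class_ring (partition_algebra k n) M \<and>
    (\<exists>e. monoid \<lparr>carrier = M, mult = mult (partition_algebra k n), one = e\<rparr>)"
proof -
  have "\<one>\<^bsub>partition_algebra k n\<^esub> \<in> carrier (partition_algebra k n)"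
    using diagram_id_in_diagrams by (auto simp: partition_algebra_def basis_vec_def)
  then obtain r d c where blocks: "matrix_blocks (partition_algebra k n) r d c"
    using semisimple_matrix_blocks[OF vectorspace_partition_algebra mult_closed] assms(2) by blast
  have "\<exists>a b. a < r \<and> b < r \<and> a \<noteq> b \<and> d a = 1 \<and> d b = 1"
  proof (cases "k = 1")
    case True
    then show ?thesis using partition_algebra_two_blocks_one blocks by blast
  next
    case False
    then show ?thesis using partition_algebra_two_blocks[OF blocks] assms(1) by simp
  qed
  then show ?thesis using matrix_blocks.monoid_basis_of_two_blocks[OF blocks] by blast
qed

end
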